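(* Let $(P_n\mid n\in\mathbb{N})$ be an enumeration of all isomorphism types of finite posets (including the empty poset), where $P_n$ has $k_n$ points, such that $m\le n$ implies $k_m\le k_n$. Define infinite matrices indexed by positive integers: $A=(a_{mn})$, $a_{mn}=\sum_{U\in\mathcal{U}(P_n),\ P_n|_U\simeq P_m} d(U^\circ)$; $B=(b_{mn})$, $b_{mn}=|\{U\in\mathcal{U}(P_n)\mid P_n|_U\simeq P_m\}|$; $C=(c_{mn})$, defined recursively by $c_{mn}=\delta_{mn}-\sum_{j=m+1}^{n} b_{mj}c_{jn}$; $D=(d_{mn})$, $d_{mn}=d(P_n)^m$; $E=(e_{mn})$, $e_{mn}=e(m,P_n)$. Let $I=(\delta_{mn})$ and $\vec I=(\delta_{m,n-1})$. Then $A$, $B$, $C$ are upper triangular, and (1) $BC=I$, hence $C=B^{-1}$; (2) $EB=D$, hence $DC=E$; (3) $EA=\vec I E$; that is, if $E_m$ denotes the $m$-th row of $E$, then $E_mA=E_{m+1}$.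
   Context: For a finite poset $P$ on $K$, $\mathcal{U}(P)$ is its set of upsets, $d(\cdot)$ the number of downsets, $P|_U$ the induced subposet, and for $U\subseteq K$, $U^\circ=K\setminus\{y\mid \exists x\in K\setminus U: x\le_P y\}$, with $d(U^\circ)$ the downset number of the subposet induced on $U^\circ$. For a finite poset $Q$ on $L$ and a finite set $M$ disjoint from $L$ with $|M|=m$, $e(m,Q)$ is the number of partial orders on $M\cup L$ inducing $Q$ on $L$ whose set of minimal elements is exactly $M$. $\delta$ is the Kronecker delta. Matrix products are the usual ones (all occurring sums are finite). *)

theory Defs
  imports Main
begin

text \<open>
  A poset on \<open>K\<close> is a relation \<open>P\<close> with \<^term>\<open>Partial_order P\<close> and \<open>K = Field P\<close>, where
  \<open>(x, y) \<in> P\<close> means \<open>x \<le>\<^sub>P y\<close>; the empty poset is \<open>{}\<close>.  The subposet induced on \<open>U \<subseteq> K\<close> is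
  \<^term>\<open>Restr P U\<close>.
\<close>

text \<open>By \<open>iso_iff2\<close>, \<^term>\<open>iso P Q f\<close> says that \<open>f\<close> is an order isomorphism, for arbitrary relations.\<close>

definition poset_iso :: "'a rel \<Rightarrow> 'b rel \<Rightarrow> bool"  (infix \<open>\<simeq>\<close> 50)
  where "P \<simeq> Q \<longleftrightarrow> (\<exists>f. iso P Q f)"

definition upsets :: "'a rel \<Rightarrow> 'a set set"
  where "upsets P = {U. U \<subseteq> Field P \<and> (\<forall>x\<in>U. \<forall>y. (x, y) \<in> P \<longrightarrow> y \<in> U)}"

definition downsets :: "'a rel \<Rightarrow> 'a set set"
  where "downsets P = {V. V \<subseteq> Field P \<and> (\<forall>y\<in>V. \<forall>x. (x, y) \<in> P \<longrightarrow> x \<in> V)}"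

definition num_downsets :: "'a rel \<Rightarrow> nat"
  where "num_downsets P = card (downsets P)"

definition circ :: "'a rel \<Rightarrow> 'a set \<Rightarrow> 'a set"
  where "circ P U = Field P - {y. \<exists>x\<in>Field P - U. (x, y) \<in> P}"

definition minimals :: "'a rel \<Rightarrow> 'a set"
  where "minimals R = {x \<in> Field R. \<forall>y. (y, x) \<in> R \<longrightarrow> y = x}"

definition min_extensions :: "'a set \<Rightarrow> 'a rel \<Rightarrow> 'a rel set"
  where "min_extensions M Q =
    {R. partial_order_on (M \<union> Field Q) R \<and> Restr R (Field Q) = Q \<and> minimals R = M}"

text \<open>
  The choice of \<open>M\<close> is immaterial, see \<open>num_min_extensions_eq\<close>.  A suitable \<open>M\<close> exists whenever
  \<open>Q\<close> is finite and the type of points is infinite.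
\<close>

definition num_min_extensions :: "nat \<Rightarrow> 'a rel \<Rightarrow> nat"
  where "num_min_extensions m Q =
    card (min_extensions (SOME M. finite M \<and> card M = m \<and> M \<inter> Field Q = {}) Q)"

lemma card_min_extensions_le:
  fixes Q :: "'a rel"
  assumes Q: "finite Q" and M: "finite M" "M \<inter> Field Q = {}"
    and M': "finite M'" "M' \<inter> Field Q = {}" and card: "card M = card M'"
  shows "card (min_extensions M Q) \<le> card (min_extensions M' Q)"
proof -
  obtain g where g: "bij_betw g M M'"
    using finite_same_card_bij[OF M(1) M'(1) card] by blast
  define h where "h x = (if x \<in> M then g x else x)" for x
  have hM: "h x = g x" "g x \<in> M'" if "x \<in> M" for x
    using that g by (auto simp: h_def bij_betw_def)
  have hL: "h x = x" if "x \<in> Field Q" for x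
    using that M(2) by (auto simp: h_def)
  have hM_im: "h ` M = M'" using g hM by (force simp: bij_betw_def)
  have hL_im: "h ` Field Q = Field Q" using hL by force
  have inj: "inj_on h (M \<union> Field Q)"
    using g hM hL M(2) M'(2) unfolding inj_on_def bij_betw_def by (metis Un_iff disjoint_iff)
  have ex: "map_prod h h ` R \<in> min_extensions M' Q" if R: "R \<in> min_extensions M Q" for R
  proof -
    let ?A = "M \<union> Field Q" and ?S = "map_prod h h ` R"
    have po: "partial_order_on ?A R" and res: "Restr R (Field Q) = Q" and mn: "minimals R = M"
      using R by (auto simp: min_extensions_def)
    have sub: "R \<subseteq> ?A \<times> ?A" and rf: "\<And>x. x \<in> ?A \<Longrightarrow> (x, x) \<in> R"
      and tr: "trans R" and asy: "antisym R"
      using partial_order_onD[OF po] by (auto simp: refl_on_def)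
    have mem: "(h x, h y) \<in> ?S \<longleftrightarrow> (x, y) \<in> R" if "x \<in> ?A" "y \<in> ?A" for x y
    proof
      assume "(h x, h y) \<in> ?S"
      then obtain u v where uv: "(u, v) \<in> R" "h x = h u" "h y = h v" by auto
      then have "u \<in> ?A" "v \<in> ?A" using sub by auto
      then have "x = u" "y = v" using uv that inj_onD[OF inj] by auto
      then show "(x, y) \<in> R" using uv by simp
    qed (rule rev_image_eqI, auto)
    have im: "h ` ?A = M' \<union> Field Q" using hM_im hL_im by (simp add: image_Un)
    have subS: "?S \<subseteq> (M' \<union> Field Q) \<times> (M' \<union> Field Q)" unfolding im[symmetric] using sub by auto
    have rep: "\<exists>x\<in>?A. a = h x" if "a \<in> M' \<union> Field Q" for a using that im by blast
    have repS: "\<exists>x\<in>?A. \<exists>y\<in>?A. a = h x \<and> b = h y" if "(a, b) \<in> ?S" for a b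
      using that sub by auto
    have "refl_on (M' \<union> Field Q) ?S" using rep rf mem unfolding refl_on_def by metis
    moreover have "trans ?S"
    proof (rule transI)
      fix a b c assume ab: "(a, b) \<in> ?S" and bc: "(b, c) \<in> ?S"
      obtain x y where xy: "x \<in> ?A" "y \<in> ?A" "a = h x" "b = h y" using repS[OF ab] by blast
      obtain z where z: "z \<in> ?A" "c = h z" using repS[OF bc] by blast
      have "(x, y) \<in> R" "(y, z) \<in> R" using ab bc xy z by (simp_all only: mem)
      then have "(x, z) \<in> R" by (rule transD[OF tr])
      then show "(a, c) \<in> ?S" using xy z by (simp only: mem)
    qed
    moreover have "antisym ?S"
    proof (rule antisymI)
      fix a b assume ab: "(a, b) \<in> ?S" and ba: "(b, a) \<in> ?S"
      obtain x y where xy: "x \<in> ?A" "y \<in> ?A" "a = h x" "b = h y" using repS[OF ab] by blast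
      have "(x, y) \<in> R" "(y, x) \<in> R" using ab ba xy by (simp_all only: mem)
      then show "a = b" using antisymD[OF asy] xy by blast
    qed
    ultimately have poS: "partial_order_on (M' \<union> Field Q) ?S"
      using subS by (simp add: partial_order_on_def preorder_on_def)
    have FR: "Field R = ?A"
      using FieldI1[OF rf] sub by (auto simp: Field_def[of R])
    have FS: "Field ?S = h ` ?A"
      using FieldI1[OF refl_onD[OF \<open>refl_on (M' \<union> Field Q) ?S\<close>]] subS
      unfolding im by (auto simp: Field_def[of ?S])
    have "Restr ?S (Field Q) = Q"
    proof -
      have "(a, b) \<in> Restr ?S (Field Q) \<longleftrightarrow> (a, b) \<in> Q" for a b
      proof (cases "a \<in> Field Q \<and> b \<in> Field Q")
        case True
        then have "(a, b) \<in> ?S \<longleftrightarrow> (a, b) \<in> R" using mem[of a b] hL by simp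
        then show ?thesis using True res by blast
      next
        case False
        then show ?thesis by (auto simp: Field_def)
      qed
      then show ?thesis by auto
    qed
    moreover have "minimals ?S = M'"
    proof -
      have iff: "h x \<in> minimals ?S \<longleftrightarrow> x \<in> minimals R" if x: "x \<in> ?A" for x
      proof -
        have "(\<forall>b. (b, h x) \<in> ?S \<longrightarrow> b = h x) \<longleftrightarrow> (\<forall>y. (y, x) \<in> R \<longrightarrow> y = x)"
        proof (intro iffI allI impI)
          fix y assume H: "\<forall>b. (b, h x) \<in> ?S \<longrightarrow> b = h x" and yx: "(y, x) \<in> R"
          have y: "y \<in> ?A" using yx sub by blast
          then have "(h y, h x) \<in> ?S" using yx x by (simp only: mem)
          then have "h y = h x" by (rule H[rule_format])
          then show "y = x" using y x by (rule inj_onD[OF inj])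
        next
          fix b assume H: "\<forall>y. (y, x) \<in> R \<longrightarrow> y = x" and bx: "(b, h x) \<in> ?S"
          obtain y where y: "y \<in> ?A" "b = h y" using repS[OF bx] by blast
          then have "(y, x) \<in> R" using bx x by (simp only: mem)
          then show "b = h x" using H y by blast
        qed
        then show ?thesis using x FR FS by (simp add: minimals_def)
      qed
      show ?thesis unfolding hM_im[symmetric]
      proof (intro equalityI subsetI)
        fix a assume a: "a \<in> minimals ?S"
        then obtain x where x: "x \<in> ?A" "a = h x" using FS by (auto simp: minimals_def)
        then have "x \<in> M" using a iff[OF x(1)] mn by simp
        then show "a \<in> h ` M" using x by simp
      next
        fix a assume "a \<in> h ` M"
        then obtain x where "x \<in> M" "a = h x" by blast
        then show "a \<in> minimals ?S" using iff[of x] mn by simp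
      qed
    qed
    ultimately show ?thesis using poS by (simp add: min_extensions_def)
  qed
  have "inj_on (\<lambda>R. map_prod h h ` R) (Pow ((M \<union> Field Q) \<times> (M \<union> Field Q)))"
    by (intro inj_on_image_Pow map_prod_inj_on inj)
  moreover have "min_extensions M Q \<subseteq> Pow ((M \<union> Field Q) \<times> (M \<union> Field Q))"
    unfolding min_extensions_def using partial_order_onD(4) by blast
  ultimately have inj2: "inj_on (\<lambda>R. map_prod h h ` R) (min_extensions M Q)"
    by (rule inj_on_subset)
  have "min_extensions M' Q \<subseteq> Pow ((M' \<union> Field Q) \<times> (M' \<union> Field Q))"
    unfolding min_extensions_def using partial_order_onD(4) by blast
  then have "finite (min_extensions M' Q)"
    using Q M'(1) finite_Field by (meson finite_Pow_iff finite_SigmaI finite_UnI finite_subset)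
  then show ?thesis using card_inj_on_le[OF inj2] ex by blast
qed

lemma num_min_extensions_eq:
  assumes "finite Q" and "finite M" and "card M = m" and "M \<inter> Field Q = {}"
  shows "num_min_extensions m Q = card (min_extensions M Q)"
proof -
  define M' where "M' = (SOME M. finite M \<and> card M = m \<and> M \<inter> Field Q = {})"
  have "finite M' \<and> card M' = m \<and> M' \<inter> Field Q = {}"
    unfolding M'_def by (rule someI[of _ M]) (use assms in blast)
  then have "card (min_extensions M' Q) = card (min_extensions M Q)"
    using assms by (intro antisym card_min_extensions_le) auto
  then show ?thesis by (simp add: num_min_extensions_def M'_def)
qed

text \<open>
  Infinite matrices are indexed by the positive integers: the entries with an index \<open>0\<close> are junk and
  are never referred to.  Row \<open>m\<close> of \<open>X\<close> is the partial application \<open>X m\<close>.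
\<close>

type_synonym imat = "nat \<Rightarrow> nat \<Rightarrow> int"

definition imat_eq :: "imat \<Rightarrow> imat \<Rightarrow> bool"
  where "imat_eq X Y \<longleftrightarrow> (\<forall>m\<ge>1. \<forall>n\<ge>1. X m n = Y m n)"

definition upper_triangular :: "imat \<Rightarrow> bool"
  where "upper_triangular X \<longleftrightarrow> (\<forall>m\<ge>1. \<forall>n\<ge>1. n < m \<longrightarrow> X m n = 0)"

text \<open>
  Sums over all positive integers; they are meaningful if only finitely many summands are nonzero,
  which is what \<open>imat_mult_defined\<close> expresses.
\<close>

definition row_mult :: "(nat \<Rightarrow> int) \<Rightarrow> imat \<Rightarrow> nat \<Rightarrow> int"
  where "row_mult v X n = (\<Sum>j | 1 \<le> j \<and> v j * X j n \<noteq> 0. v j * X j n)"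

definition imat_mult :: "imat \<Rightarrow> imat \<Rightarrow> imat"
  where "imat_mult X Y = (\<lambda>m. row_mult (X m) Y)"

definition imat_mult_defined :: "imat \<Rightarrow> imat \<Rightarrow> bool"
  where "imat_mult_defined X Y \<longleftrightarrow>
    (\<forall>m\<ge>1. \<forall>n\<ge>1. finite {j. 1 \<le> j \<and> X m j * Y j n \<noteq> 0})"

definition imat_id :: imat
  where "imat_id m n = (if m = n then 1 else 0)"

definition imat_shift :: imat
  where "imat_shift m n = (if m + 1 = n then 1 else 0)"

definition imat_inverse :: "imat \<Rightarrow> imat \<Rightarrow> bool"
  where "imat_inverse X Y \<longleftrightarrow>
    imat_mult_defined X Y \<and> imat_eq (imat_mult X Y) imat_id \<and>
    imat_mult_defined Y X \<and> imat_eq (imat_mult Y X) imat_id"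

definition matA :: "(nat \<Rightarrow> 'a rel) \<Rightarrow> imat"
  where "matA P m n =
    int (\<Sum>U | U \<in> upsets (P n) \<and> Restr (P n) U \<simeq> P m. num_downsets (Restr (P n) (circ (P n) U)))"

definition matB :: "(nat \<Rightarrow> 'a rel) \<Rightarrow> imat"
  where "matB P m n = int (card {U \<in> upsets (P n). Restr (P n) U \<simeq> P m})"

function matC :: "(nat \<Rightarrow> 'a rel) \<Rightarrow> imat"
  where "matC P m n = (if m = n then 1 else 0) - (\<Sum>j = m + 1..n. matB P m j * matC P j n)"
  by auto
termination
  by (relation "measure (\<lambda>(P, m, n). Suc n - m)") auto

declare matC.simps [simp del]

definition matD :: "(nat \<Rightarrow> 'a rel) \<Rightarrow> imat"
  where "matD P m n = int (num_downsets (P n) ^ m)"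

definition matE :: "(nat \<Rightarrow> 'a rel) \<Rightarrow> imat"
  where "matE P m n = int (num_min_extensions m (P n))"

text \<open>
  \<open>(P\<^sub>n | n \<ge> 1)\<close> lists every isomorphism type of finite posets exactly once, by increasing number of
  points.  Every finite poset is isomorphic to one whose points are natural numbers, so it suffices
  that those are covered.
\<close>

definition poset_enumeration :: "(nat \<Rightarrow> 'a rel) \<Rightarrow> bool"
  where "poset_enumeration P \<longleftrightarrow>
    (\<forall>n\<ge>1. finite (P n) \<and> Partial_order (P n)) \<and>
    (\<forall>m\<ge>1. \<forall>n\<ge>1. P m \<simeq> P n \<longrightarrow> m = n) \<and>
    (\<forall>Q :: nat rel. finite Q \<and> Partial_order Q \<longrightarrow> (\<exists>n\<ge>1. Q \<simeq> P n)) \<and>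
    (\<forall>m\<ge>1. \<forall>n\<ge>1. m \<le> n \<longrightarrow> card (Field (P m)) \<le> card (Field (P n)))"

end

theory Submission
  imports Defs
begin

text \<open>
  The number \<open>e(m, Q)\<close> counts the sequences of \<open>m\<close> upsets of \<open>Q\<close> whose union is \<open>Q\<close>.  Sorting all
  sequences of \<open>m\<close> upsets of \<open>P\<^sub>n\<close> by their union \<open>U\<close>, and \<open>U\<close> by its isomorphism type, gives
  \<open>EB = D\<close>; sorting the sequences of \<open>m + 1\<close> upsets with union \<open>P\<^sub>n\<close> by the union of all but one of them
  gives the recursion \<open>EA = SE\<close> with the shift matrix \<open>S\<close>.  The matrix \<open>B\<close> is unitriangular, and the
  recursion for \<open>C\<close> is \<open>BC = I\<close> solved for \<open>C\<close>.
\<close>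

section \<open>Isomorphism of posets\<close>

lemma poset_iso_refl: "P \<simeq> P"
  unfolding poset_iso_def iso_iff2 by (intro exI[of _ id]) auto

lemma poset_iso_sym:
  assumes "P \<simeq> Q" shows "Q \<simeq> P"
proof -
  obtain f where bij: "bij_betw f (Field P) (Field Q)"
    and ord: "\<forall>a\<in>Field P. \<forall>b\<in>Field P. (a, b) \<in> P \<longleftrightarrow> (f a, f b) \<in> Q"
    using assms unfolding poset_iso_def iso_iff2 by blast
  let ?g = "inv_into (Field P) f"
  have "\<And>a. a \<in> Field Q \<Longrightarrow> ?g a \<in> Field P \<and> f (?g a) = a"
    using bij by (metis bij_betw_imp_surj_on f_inv_into_f inv_into_into)
  then have "iso Q P ?g"
    unfolding iso_iff2 using bij ord by (simp add: bij_betw_inv_into)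
  then show ?thesis unfolding poset_iso_def by blast
qed

lemma poset_iso_trans:
  assumes "P \<simeq> Q" "Q \<simeq> R" shows "P \<simeq> R"
proof -
  obtain f g where fg: "iso P Q f" "iso Q R g"
    using assms unfolding poset_iso_def by blast
  then have "\<And>a. a \<in> Field P \<Longrightarrow> f a \<in> Field Q"
    unfolding iso_iff2 bij_betw_def by blast
  then have "iso P R (g \<circ> f)"
    using fg unfolding iso_iff2 by (auto intro: bij_betw_trans)
  then show ?thesis unfolding poset_iso_def by blast
qed

lemma poset_iso_card_Field: "P \<simeq> Q \<Longrightarrow> card (Field P) = card (Field Q)"
  unfolding poset_iso_def iso_iff2 using bij_betw_same_card by blast

lemma Partial_order_iso_image:
  assumes P: "Partial_order P" and inj: "inj_on f (Field P)"
  shows "Partial_order (map_prod f f ` P)" "P \<simeq> map_prod f f ` P"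
proof -
  let ?S = "map_prod f f ` P"
  have F: "Field ?S = f ` Field P" by (force simp: Field_def)
  have mem: "(f x, f y) \<in> ?S \<longleftrightarrow> (x, y) \<in> P" if "x \<in> Field P" "y \<in> Field P" for x y
  proof
    assume "(f x, f y) \<in> ?S"
    then obtain u v where uv: "(u, v) \<in> P" "f x = f u" "f y = f v" by auto
    then have "x = u" "y = v"
      using that inj_onD[OF inj] FieldI1[OF uv(1)] FieldI2[OF uv(1)] by auto
    then show "(x, y) \<in> P" using uv by simp
  qed (rule rev_image_eqI, auto)
  have "iso P ?S f" unfolding iso_iff2 F using inj mem by (auto simp: bij_betw_def)
  then show "P \<simeq> ?S" unfolding poset_iso_def by blast
  have rf: "\<And>x. x \<in> Field P \<Longrightarrow> (x, x) \<in> P" and tr: "trans P" and asy: "antisym P"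
    using partial_order_onD[OF P] by (auto simp: refl_on_def)
  have rep: "\<exists>x\<in>Field P. \<exists>y\<in>Field P. a = f x \<and> b = f y" if "(a, b) \<in> ?S" for a b
    using that by (force simp: Field_def)
  have "refl_on (Field ?S) ?S" unfolding refl_on_def F using rf mem by blast
  moreover have "?S \<subseteq> Field ?S \<times> Field ?S" by (auto simp: Field_def)
  moreover have "trans ?S"
  proof (rule transI)
    fix a b c assume ab: "(a, b) \<in> ?S" and bc: "(b, c) \<in> ?S"
    obtain x y where xy: "x \<in> Field P" "y \<in> Field P" "a = f x" "b = f y" using rep[OF ab] by blast
    obtain z where z: "z \<in> Field P" "c = f z" using rep[OF bc] by blast
    have "(x, y) \<in> P" "(y, z) \<in> P" using ab bc xy z by (simp_all only: mem)
    then have "(x, z) \<in> P" by (rule transD[OF tr])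
    then show "(a, c) \<in> ?S" using xy z by (simp only: mem)
  qed
  moreover have "antisym ?S"
  proof (rule antisymI)
    fix a b assume ab: "(a, b) \<in> ?S" and ba: "(b, a) \<in> ?S"
    obtain x y where xy: "x \<in> Field P" "y \<in> Field P" "a = f x" "b = f y" using rep[OF ab] by blast
    have "(x, y) \<in> P" "(y, x) \<in> P" using ab ba xy by (simp_all only: mem)
    then show "a = b" using antisymD[OF asy] xy by blast
  qed
  ultimately show "Partial_order ?S"
    by (simp add: partial_order_on_def preorder_on_def)
qed

lemma finite_poset_iso_nat:
  assumes "finite P" "Partial_order P"
  obtains Q :: "nat rel" where "finite Q" "Partial_order Q" "P \<simeq> Q"
proof -
  obtain f :: "'a \<Rightarrow> nat" where "inj_on f (Field P)"
    using finite_imp_inj_to_nat_seg[OF finite_Field[OF assms(1)]] by blast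
  then show ?thesis
    using Partial_order_iso_image[OF assms(2)] assms(1) that[of "map_prod f f ` P"] by blast
qed

text \<open>Reflexivity keeps every point of \<open>U\<close> in the field, even one related to no
  other point of \<open>U\<close>.\<close>

lemma Partial_order_Field_Restr:
  assumes "Partial_order P" "U \<subseteq> Field P"
  shows "Field (Restr P U) = U"
  using partial_order_onD(1)[OF assms(1)] assms(2) by (force simp: Field_def refl_on_def)

lemma Partial_order_Restr:
  assumes P: "Partial_order P" and U: "U \<subseteq> Field P"
  shows "Partial_order (Restr P U)"
  unfolding Partial_order_Field_Restr[OF assms]
  using partial_order_onD[OF P] U
  by (auto simp: partial_order_on_def preorder_on_def refl_on_def trans_Restr antisym_def)

lemma Restr_Field_self: "Restr P (Field P) = P"
  by (auto simp: Field_def)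

section \<open>Upsets, downsets and covers by upsets\<close>

lemma finite_upsets: "finite P \<Longrightarrow> finite (upsets P)"
  by (rule finite_subset[of _ "Pow (Field P)"]) (auto simp: upsets_def finite_Field)

text \<open>\<open>circ P U\<close> is the largest downset of \<open>P\<close> inside
  \<open>U\<close>. Complementation in \<open>Field P\<close> sends the upsets that contain the
  complement of \<open>U\<close> to the downsets of \<open>P\<close> inside \<open>U\<close>, which
  are exactly the downsets of the subposet on \<open>circ P U\<close>.\<close>

lemma card_upsets_containing:
  assumes P: "Partial_order P" and U: "U \<subseteq> Field P"
  shows "card {V \<in> upsets P. Field P - U \<subseteq> V} = num_downsets (Restr P (circ P U))"
proof -
  have c: "circ P U \<subseteq> Field P" by (auto simp: circ_def)
  have F: "Field (Restr P (circ P U)) = circ P U" by (rule Partial_order_Field_Restr[OF P c])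
  have tr: "trans P" and rf: "\<And>x. x \<in> Field P \<Longrightarrow> (x, x) \<in> P"
    using partial_order_onD[OF P] by (auto simp: refl_on_def)
  have "bij_betw (\<lambda>V. Field P - V) {V \<in> upsets P. Field P - U \<subseteq> V}
          (downsets (Restr P (circ P U)))"
  proof (rule bij_betw_byWitness[where f' = "\<lambda>V. Field P - V"])
    show "(\<lambda>V. Field P - V) ` {V \<in> upsets P. Field P - U \<subseteq> V} \<subseteq> downsets (Restr P (circ P U))"
      unfolding downsets_def F by (fastforce simp: upsets_def circ_def)
    \<comment> \<open>Transitivity makes \<open>circ P U\<close> a downset of \<open>P\<close>, so
      downsets of the subposet on it are downsets of \<open>P\<close>.\<close>
    have down: "x \<in> circ P U" if "(x, y) \<in> P" "y \<in> circ P U" for x y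
      using that transD[OF tr] by (auto simp: circ_def FieldI1)
    show "(\<lambda>V. Field P - V) ` downsets (Restr P (circ P U)) \<subseteq> {V \<in> upsets P. Field P - U \<subseteq> V}"
    proof (rule image_subsetI)
      fix W assume "W \<in> downsets (Restr P (circ P U))"
      then have W: "W \<subseteq> circ P U"
        and dn: "\<And>x y. y \<in> W \<Longrightarrow> (x, y) \<in> P \<Longrightarrow> x \<in> circ P U \<Longrightarrow> x \<in> W"
        unfolding downsets_def F by auto
      have "Field P - W \<in> upsets P"
        unfolding upsets_def using W dn down by (auto intro: FieldI2)
      moreover have "circ P U \<subseteq> U" using rf U by (auto simp: circ_def)
      ultimately show "Field P - W \<in> {V \<in> upsets P. Field P - U \<subseteq> V}" using W by blast
    qed
  qed (use c in \<open>auto simp: upsets_def downsets_def F\<close>)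
  then show ?thesis unfolding num_downsets_def by (rule bij_betw_same_card)
qed

lemma card_upsets:
  assumes "Partial_order P" shows "card (upsets P) = num_downsets P"
proof -
  have "circ P (Field P) = Field P" by (auto simp: circ_def)
  then show ?thesis
    using card_upsets_containing[OF assms, of "Field P"] by (simp add: Restr_Field_self)
qed

text \<open>Since \<open>U\<close> is an upset, nothing above a point of \<open>U\<close> escapes
  from \<open>U\<close>, so upward closure within \<open>U\<close> and within \<open>P\<close> agree
  for subsets of \<open>U\<close>.\<close>

lemma upsets_Restr:
  assumes "Partial_order P" "U \<in> upsets P"
  shows "upsets (Restr P U) = {V \<in> upsets P. V \<subseteq> U}"
proof -
  have "U \<subseteq> Field P" using assms(2) by (simp add: upsets_def)
  then show ?thesis
    using assms(2) by (auto simp: upsets_def Partial_order_Field_Restr[OF assms(1)])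
qed

text \<open>Lists, because the members of a cover are later attached to \<open>m\<close> distinct
  minimal elements: order counts, and repetitions and empty members are allowed.\<close>

definition upset_covers :: "nat \<Rightarrow> 'a rel \<Rightarrow> 'a set list set"
  where "upset_covers m P = {Vs. length Vs = m \<and> set Vs \<subseteq> upsets P \<and> \<Union> (set Vs) = Field P}"

lemma upset_covers_Restr:
  assumes "Partial_order P" "U \<in> upsets P"
  shows "upset_covers m (Restr P U) = {Vs. length Vs = m \<and> set Vs \<subseteq> upsets P \<and> \<Union> (set Vs) = U}"
proof -
  have "U \<subseteq> Field P" using assms(2) by (simp add: upsets_def)
  then show ?thesis
    unfolding upset_covers_def upsets_Restr[OF assms]
    by (auto simp: Partial_order_Field_Restr[OF assms(1)])
qed

lemma Union_upsets: "\<V> \<subseteq> upsets P \<Longrightarrow> \<Union> \<V> \<in> upsets P"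
  unfolding upsets_def by blast

lemma finite_upset_covers: "finite P \<Longrightarrow> finite (upset_covers m P)"
  by (rule finite_subset[OF _ finite_lists_length_eq[OF finite_upsets, of P m]])
    (auto simp: upset_covers_def)

lemma finite_Restr: "finite P \<Longrightarrow> finite (Restr P U)"
  by blast

text \<open>Every sequence of \<open>m\<close> upsets covers exactly one upset, its union, so the
  covers of the various \<open>U\<close> partition all such sequences. This is \<open>EB = D\<close>
  before the upsets are sorted by type.\<close>

lemma sum_card_upset_covers_Restr:
  assumes "finite P" "Partial_order P"
  shows "(\<Sum>U\<in>upsets P. card (upset_covers m (Restr P U))) = num_downsets P ^ m"
proof -
  have "num_downsets P ^ m = card {Vs. set Vs \<subseteq> upsets P \<and> length Vs = m}"
    by (simp only: card_lists_length_eq[OF finite_upsets[OF assms(1)]] card_upsets[OF assms(2)])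
  also have "{Vs. set Vs \<subseteq> upsets P \<and> length Vs = m} =
      (\<Union>U\<in>upsets P. upset_covers m (Restr P U))"
  proof (intro equalityI subsetI)
    fix Vs assume Vs: "Vs \<in> {Vs. set Vs \<subseteq> upsets P \<and> length Vs = m}"
    then have U: "\<Union> (set Vs) \<in> upsets P" by (intro Union_upsets) simp
    then have "Vs \<in> upset_covers m (Restr P (\<Union> (set Vs)))"
      using Vs by (simp add: upset_covers_Restr[OF assms(2)])
    then show "Vs \<in> (\<Union>U\<in>upsets P. upset_covers m (Restr P U))" by (rule UN_I[OF U])
  next
    fix Vs assume "Vs \<in> (\<Union>U\<in>upsets P. upset_covers m (Restr P U))"
    then obtain U where "U \<in> upsets P" "Vs \<in> upset_covers m (Restr P U)" by (rule UN_E)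
    then show "Vs \<in> {Vs. set Vs \<subseteq> upsets P \<and> length Vs = m}"
      by (simp add: upset_covers_Restr[OF assms(2)])
  qed
  also have "card \<dots> = (\<Sum>U\<in>upsets P. card (upset_covers m (Restr P U)))"
  proof (intro card_UN_disjoint finite_upsets assms(1) ballI impI)
    show "finite (upset_covers m (Restr P U))" for U
      by (rule finite_upset_covers[OF finite_Restr[OF assms(1)]])
  qed (auto simp: upset_covers_Restr[OF assms(2)])
  finally show ?thesis by (rule sym)
qed

text \<open>
  Let \<open>U\<close> be the union of the tail of a cover.  The head is then any upset containing the complement
  of \<open>U\<close>, and these upsets are the complements of the downsets contained in \<open>circ P U\<close>.
\<close>

lemma card_upset_covers_Suc:
  assumes "finite P" "Partial_order P"
  shows "card (upset_covers (Suc m) P) =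
    (\<Sum>U\<in>upsets P. card (upset_covers m (Restr P U)) * num_downsets (Restr P (circ P U)))"
proof -
  \<comment> \<open>\<open>T U\<close> consists of the covers whose tail has union \<open>U\<close>.
    Since \<open>U\<close> can be read off from the tail, these sets are disjoint.\<close>
  define T where "T U = (\<lambda>(V, Vs). V # Vs) `
    ({V \<in> upsets P. Field P - U \<subseteq> V} \<times> upset_covers m (Restr P U))" for U
  have fin: "finite ({V \<in> upsets P. Field P - U \<subseteq> V} \<times> upset_covers m (Restr P U))" for U
    using finite_upsets[OF assms(1)] finite_upset_covers[OF finite_Restr[OF assms(1)]] by auto
  have T: "Ws \<in> T U \<longleftrightarrow> (\<exists>V Vs. Ws = V # Vs \<and> V \<in> upsets P \<and> Field P - U \<subseteq> V \<and>
      length Vs = m \<and> set Vs \<subseteq> upsets P \<and> \<Union> (set Vs) = U)" if "U \<in> upsets P" for Ws U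
    unfolding T_def upset_covers_Restr[OF assms(2) that] by auto
  have "upset_covers (Suc m) P = (\<Union>U\<in>upsets P. T U)"
  proof (intro equalityI subsetI)
    fix Ws assume "Ws \<in> upset_covers (Suc m) P"
    then obtain V Vs where W: "Ws = V # Vs" "length Vs = m" "V \<in> upsets P" "set Vs \<subseteq> upsets P"
      "V \<union> \<Union> (set Vs) = Field P"
      by (auto simp: upset_covers_def length_Suc_conv)
    have U: "\<Union> (set Vs) \<in> upsets P" using W(4) by (rule Union_upsets)
    have "Ws \<in> T (\<Union> (set Vs))" unfolding T[OF U] using W by blast
    then show "Ws \<in> (\<Union>U\<in>upsets P. T U)" by (rule UN_I[OF U])
  next
    fix Ws assume "Ws \<in> (\<Union>U\<in>upsets P. T U)"
    then obtain U where U: "U \<in> upsets P" "Ws \<in> T U" by (rule UN_E)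
    then obtain V Vs where W: "Ws = V # Vs" "V \<in> upsets P" "Field P - U \<subseteq> V"
      "length Vs = m" "set Vs \<subseteq> upsets P" "\<Union> (set Vs) = U"
      unfolding T[OF U(1)] by (elim exE conjE)
    moreover have "V \<subseteq> Field P" "U \<subseteq> Field P" using U(1) W(2) by (auto simp: upsets_def)
    ultimately show "Ws \<in> upset_covers (Suc m) P" by (auto simp: upset_covers_def)
  qed
  moreover have "card (\<Union>U\<in>upsets P. T U) = (\<Sum>U\<in>upsets P. card (T U))"
  proof (intro card_UN_disjoint finite_upsets assms(1) ballI impI)
    show "finite (T U)" for U unfolding T_def by (rule finite_imageI[OF fin])
  qed (auto simp: T)
  moreover have "card (T U) =
      card (upset_covers m (Restr P U)) * num_downsets (Restr P (circ P U))" if "U \<in> upsets P" for U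
  proof -
    have "card (T U) = card ({V \<in> upsets P. Field P - U \<subseteq> V} \<times> upset_covers m (Restr P U))"
      unfolding T_def by (rule card_image) (auto simp: inj_on_def)
    then show ?thesis
      using card_upsets_containing[OF assms(2), of U] that
      by (simp add: card_cartesian_product upsets_def mult.commute)
  qed
  ultimately show ?thesis by simp
qed

text \<open>Applying an isomorphism to each member of a list carries covers of \<open>P\<close>
  injectively to covers of \<open>Q\<close>. The reverse inequality follows by exchanging the two
  posets.\<close>

lemma card_upset_covers_iso_le:
  assumes "finite Q" "P \<simeq> Q"
  shows "card (upset_covers m P) \<le> card (upset_covers m Q)"
proof -
  obtain f where bij: "bij_betw f (Field P) (Field Q)"
    and ord: "\<forall>a\<in>Field P. \<forall>b\<in>Field P. (a, b) \<in> P \<longleftrightarrow> (f a, f b) \<in> Q"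
    using assms unfolding poset_iso_def iso_iff2 by blast
  have im: "f ` Field P = Field Q" and inj: "inj_on f (Field P)"
    using bij by (auto simp: bij_betw_def)
  have up: "f ` V \<in> upsets Q" if V: "V \<in> upsets P" for V
  proof -
    have sub: "V \<subseteq> Field P" using V by (simp add: upsets_def)
    have "z \<in> f ` V" if x: "x \<in> V" and z: "(f x, z) \<in> Q" for x z
    proof -
      obtain y where y: "y \<in> Field P" "z = f y" using FieldI2[OF z] im by blast
      then have "(x, y) \<in> P" using ord[THEN bspec, THEN bspec, of x y] x z sub by auto
      then show ?thesis using V x unfolding y(2) by (auto simp: upsets_def)
    qed
    moreover have "f ` V \<subseteq> Field Q" using sub im by blast
    ultimately show ?thesis by (auto simp: upsets_def)
  qed
  have "map ((`) f) ` upset_covers m P \<subseteq> upset_covers m Q"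
  proof (rule image_subsetI)
    fix Vs assume "Vs \<in> upset_covers m P"
    then have Vs: "length Vs = m" "set Vs \<subseteq> upsets P" "\<Union> (set Vs) = Field P"
      by (simp_all add: upset_covers_def)
    have "\<Union> (set (map ((`) f) Vs)) = f ` \<Union> (set Vs)" by auto
    then have "\<Union> (set (map ((`) f) Vs)) = Field Q" unfolding Vs(3) im .
    moreover have "set (map ((`) f) Vs) \<subseteq> upsets Q" using Vs(2) up by auto
    ultimately show "map ((`) f) Vs \<in> upset_covers m Q" using Vs(1) by (simp add: upset_covers_def)
  qed
  moreover have "inj_on (map ((`) f)) (upset_covers m P)"
  proof (rule inj_on_subset[OF inj_on_mapI])
    show "upset_covers m P \<subseteq> lists (upsets P)" by (auto simp: upset_covers_def)
    show "inj_on ((`) f) (\<Union> (set ` lists (upsets P)))"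
      by (rule inj_on_subset[OF inj_on_image_Pow[OF inj]]) (auto simp: upsets_def)
  qed
  ultimately show ?thesis by (intro card_inj_on_le finite_upset_covers[OF assms(1)])
qed

lemma card_upset_covers_iso:
  assumes "finite P" "finite Q" "P \<simeq> Q"
  shows "card (upset_covers m P) = card (upset_covers m Q)"
  using card_upset_covers_iso_le[OF assms(2,3)]
    card_upset_covers_iso_le[OF assms(1) poset_iso_sym[OF assms(3)]] by (rule antisym)

section \<open>Extensions by minimal elements are covers by upsets\<close>

text \<open>
  An extension of \<open>Q\<close> by the minimal elements \<open>M\<close> is determined by the upsets \<open>{y \<in> Field Q. x < y}\<close>
  for \<open>x \<in> M\<close>; they cover \<open>Q\<close> because no point of \<open>Q\<close> is minimal in the extension.
\<close>

lemma min_extensions_decompose: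
  assumes Q: "finite Q" and M: "finite M" "M \<inter> Field Q = {}" and R: "R \<in> min_extensions M Q"
  shows "R = Q \<union> Id_on M \<union> (SIGMA x:M. {y \<in> Field Q. (x, y) \<in> R})"
    and "\<And>x. {y \<in> Field Q. (x, y) \<in> R} \<in> upsets Q"
    and "(\<Union>x\<in>M. {y \<in> Field Q. (x, y) \<in> R}) = Field Q"
proof -
  let ?A = "M \<union> Field Q"
  have po: "partial_order_on ?A R" and res: "Restr R (Field Q) = Q" and mn: "minimals R = M"
    using R by (auto simp: min_extensions_def)
  have sub: "R \<subseteq> ?A \<times> ?A" and rf: "\<And>x. x \<in> ?A \<Longrightarrow> (x, x) \<in> R"
    and tr: "trans R" and asy: "antisym R"
    using partial_order_onD[OF po] by (auto simp: refl_on_def)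
  have QR: "Q \<subseteq> R" by (subst res[symmetric]) (rule Int_lower1)
  have min: "y = x" if "(y, x) \<in> R" "x \<in> M" for x y
    using that mn by (auto simp: minimals_def)
  show "R = Q \<union> Id_on M \<union> (SIGMA x:M. {y \<in> Field Q. (x, y) \<in> R})"
  proof (intro equalityI subrelI)
    fix x y assume xy: "(x, y) \<in> R"
    show "(x, y) \<in> Q \<union> Id_on M \<union> (SIGMA x:M. {y \<in> Field Q. (x, y) \<in> R})"
    proof (cases "y \<in> M")
      case True
      then show ?thesis using min[OF xy] by auto
    next
      case False
      then have "x \<in> M \<union> Field Q" "y \<in> Field Q" using xy sub by auto
      moreover have "(x, y) \<in> Q" if "x \<in> Field Q"
        using that xy \<open>y \<in> Field Q\<close> by (subst res[symmetric]) simp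
      ultimately show ?thesis using xy by auto
    qed
  next
    fix x y assume "(x, y) \<in> Q \<union> Id_on M \<union> (SIGMA x:M. {y \<in> Field Q. (x, y) \<in> R})"
    then show "(x, y) \<in> R" using QR rf by auto
  qed
  show "{y \<in> Field Q. (x, y) \<in> R} \<in> upsets Q" for x
    unfolding upsets_def using QR transD[OF tr] by (auto intro: FieldI2)
  show "(\<Union>x\<in>M. {y \<in> Field Q. (x, y) \<in> R}) = Field Q"
  proof (intro equalityI subsetI)
    fix y assume y: "y \<in> Field Q"
    have fin: "finite R" using finite_subset[OF sub] M(1) finite_Field[OF Q] by simp
    \<comment> \<open>The strict part of the finite order \<open>R\<close> is well-founded, so some
      \<open>x\<close> is minimal among the points below \<open>y\<close>. By transitivity
      \<open>x\<close> is minimal in all of \<open>R\<close>, hence in \<open>M\<close>.\<close>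
    have "wf (R - Id)"
    proof (rule finite_acyclic_wf)
      show "finite (R - Id)" using fin by blast
      show "acyclic (R - Id)"
        using trancl_id[OF trans_diff_Id[OF tr asy]] by (auto simp: acyclic_def)
    qed
    moreover have "y \<in> {x. (x, y) \<in> R}" using rf y by blast
    ultimately obtain x where x: "(x, y) \<in> R" "\<And>z. (z, x) \<in> R - Id \<Longrightarrow> (z, y) \<notin> R"
      by (rule wfE_min) auto
    have "z = x" if z: "(z, x) \<in> R" for z
      using x(2)[of z] transD[OF tr z x(1)] z by auto
    then have "x \<in> minimals R" using FieldI1[OF x(1)] by (auto simp: minimals_def)
    then show "y \<in> (\<Union>x\<in>M. {y \<in> Field Q. (x, y) \<in> R})" using mn x(1) y by blast
  qed blast
qed

text \<open>The converse construction places each \<open>x\<close> in \<open>M\<close> below the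
  points of \<open>V x\<close>. Transitivity holds because \<open>V x\<close> is an upset, the
  points of \<open>M\<close> are minimal because nothing else lies below them, and the covering
  condition prevents points of \<open>Q\<close> from being minimal.\<close>

lemma min_extensions_cover:
  assumes Q: "Partial_order Q" and M: "M \<inter> Field Q = {}"
    and V: "\<And>x. x \<in> M \<Longrightarrow> V x \<in> upsets Q" and cov: "(\<Union>x\<in>M. V x) = Field Q"
  shows "Q \<union> Id_on M \<union> Sigma M V \<in> min_extensions M Q"
proof -
  let ?R = "Q \<union> Id_on M \<union> Sigma M V"
  have rf: "\<And>x. x \<in> Field Q \<Longrightarrow> (x, x) \<in> Q" and tr: "trans Q" and asy: "antisym Q"
    using partial_order_onD[OF Q] by (auto simp: refl_on_def)
  have QF: "\<And>x y. (x, y) \<in> Q \<Longrightarrow> x \<in> Field Q \<and> y \<in> Field Q" by (auto simp: Field_def)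
  have VF: "\<And>x y. x \<in> M \<Longrightarrow> y \<in> V x \<Longrightarrow> y \<in> Field Q" using V by (auto simp: upsets_def)
  have VU: "\<And>x y z. x \<in> M \<Longrightarrow> y \<in> V x \<Longrightarrow> (y, z) \<in> Q \<Longrightarrow> z \<in> V x"
    using V by (auto simp: upsets_def)
  have MF: "\<And>x. x \<in> M \<Longrightarrow> x \<notin> Field Q" using M by blast
  have "refl_on (M \<union> Field Q) ?R" using rf by (auto simp: refl_on_def)
  moreover have "?R \<subseteq> (M \<union> Field Q) \<times> (M \<union> Field Q)" using QF VF by auto
  moreover have "trans ?R"
    unfolding trans_def using transD[OF tr] QF VF VU MF by blast
  moreover have "antisym ?R"
    unfolding antisym_def using antisymD[OF asy] QF VF MF by blast
  ultimately have "partial_order_on (M \<union> Field Q) ?R"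
    by (simp add: partial_order_on_def preorder_on_def)
  moreover have "Restr ?R (Field Q) = Q" using QF MF by auto
  moreover have "minimals ?R = M"
  proof (intro equalityI subsetI)
    fix y assume y: "y \<in> minimals ?R"
    show "y \<in> M"
    proof (rule ccontr)
      assume n: "y \<notin> M"
      then have "y \<in> Field Q" using y VF by (auto simp: minimals_def Field_def)
      then obtain x where "x \<in> M" "y \<in> V x" using cov by blast
      then show False using y n by (auto simp: minimals_def)
    qed
  next
    fix x assume x: "x \<in> M"
    then have "x \<in> Field ?R" by (auto simp: Field_def)
    then show "x \<in> minimals ?R" unfolding minimals_def using x QF VF MF by blast
  qed
  ultimately show ?thesis by (simp add: min_extensions_def)
qed

text \<open>Listing \<open>M\<close> turns the upsets that belong to an extension into a list;
  \<open>min_extensions_decompose\<close> shows that this list is a cover and determines the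
  extension, \<open>min_extensions_cover\<close> that every cover arises.\<close>

lemma num_min_extensions_eq_covers:
  fixes Q :: "'a rel"
  assumes inf: "infinite (UNIV :: 'a set)" and fin: "finite Q" and Q: "Partial_order Q"
  shows "num_min_extensions m Q = card (upset_covers m Q)"
proof -
  have "infinite (- Field Q)" using inf finite_Field[OF fin] by (simp add: Compl_eq_Diff_UNIV)
  then obtain M where M: "M \<subseteq> - Field Q" "finite M" "card M = m"
    using infinite_arbitrarily_large by metis
  have MQ: "M \<inter> Field Q = {}" using M(1) by blast
  obtain ms where ms: "set ms = M" "distinct ms" using finite_distinct_list[OF M(2)] by blast
  have len: "length ms = m" using ms M(3) distinct_card by metis
  let ?up = "\<lambda>R x. {y \<in> Field Q. (x, y) \<in> R}"
  let ?F = "\<lambda>R. map (?up R) ms"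
  have "inj_on ?F (min_extensions M Q)"
  proof (rule inj_onI)
    fix R S assume R: "R \<in> min_extensions M Q" and S: "S \<in> min_extensions M Q" and eq: "?F R = ?F S"
    have "\<And>x. x \<in> M \<Longrightarrow> ?up R x = ?up S x" using eq unfolding map_eq_conv ms(1) by (rule bspec)
    then have "(SIGMA x:M. ?up R x) = (SIGMA x:M. ?up S x)" by (rule Sigma_cong[OF refl])
    then show "R = S"
      using min_extensions_decompose(1)[OF fin M(2) MQ R]
        min_extensions_decompose(1)[OF fin M(2) MQ S] by (simp only:)
  qed
  moreover have "?F ` min_extensions M Q = upset_covers m Q"
  proof (intro equalityI subsetI)
    fix Vs assume "Vs \<in> ?F ` min_extensions M Q"
    then obtain R where R: "R \<in> min_extensions M Q" "Vs = ?F R" by blast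
    then show "Vs \<in> upset_covers m Q"
      using min_extensions_decompose(2,3)[OF fin M(2) MQ R(1)] len ms(1)
      by (simp add: upset_covers_def image_subset_iff)
  next
    fix Vs assume Vs: "Vs \<in> upset_covers m Q"
    then have lenV: "length Vs = m" by (simp add: upset_covers_def)
    \<comment> \<open>\<open>V\<close> assigns to each new minimal element the entry of
      \<open>Vs\<close> at its position in \<open>ms\<close>, which is unique because
      \<open>ms\<close> is distinct.\<close>
    define V where "V x = the (map_of (zip ms Vs) x)" for x
    have mapV: "map V ms = Vs"
      unfolding V_def using ms(2) len lenV
      by (intro nth_equalityI) (auto simp: map_of_zip_nth)
    then have setV: "V ` M = set Vs" using ms(1) by (metis list.set_map)
    have V: "\<And>x. x \<in> M \<Longrightarrow> V x \<in> upsets Q" and cov: "(\<Union>x\<in>M. V x) = Field Q"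
      using Vs setV by (auto simp: upset_covers_def)
    let ?R = "Q \<union> Id_on M \<union> Sigma M V"
    have "?up ?R x = V x" if "x \<in> M" for x
      using that MQ V[OF that] by (auto simp: upsets_def dest: FieldI1)
    then have "Vs = ?F ?R" unfolding mapV[symmetric] using ms(1) by simp
    moreover have "?R \<in> min_extensions M Q" using Q MQ V cov by (rule min_extensions_cover)
    ultimately show "Vs \<in> ?F ` min_extensions M Q" by (rule image_eqI)
  qed
  ultimately have "card (min_extensions M Q) = card (upset_covers m Q)"
    by (metis (no_types, lifting) card_image)
  then show ?thesis using num_min_extensions_eq[OF fin M(2,3) MQ] by simp
qed

section \<open>Upper triangular infinite matrices\<close>

text \<open>Column \<open>n\<close> of \<open>X\<close> vanishes below row \<open>n\<close>, so at
  most the first \<open>n\<close> terms are nonzero, whatever \<open>v\<close> is. This gives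
  meaning to products whose left factor, like \<open>D\<close> or \<open>E\<close>, is not
  triangular.\<close>

lemma row_mult_upper_triangular:
  assumes "upper_triangular X" "n \<ge> 1"
  shows "finite {j. 1 \<le> j \<and> v j * X j n \<noteq> 0}" "row_mult v X n = (\<Sum>j = 1..n. v j * X j n)"
proof -
  have sub: "{j. 1 \<le> j \<and> v j * X j n \<noteq> 0} \<subseteq> {1..n}"
    using assms by (force simp: upper_triangular_def)
  then show "finite {j. 1 \<le> j \<and> v j * X j n \<noteq> 0}" by (rule finite_subset) simp
  show "row_mult v X n = (\<Sum>j = 1..n. v j * X j n)"
    unfolding row_mult_def by (rule sum.mono_neutral_left) (use sub in auto)
qed

lemma imat_mult_defined_upper_triangular: "upper_triangular Y \<Longrightarrow> imat_mult_defined X Y"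
  unfolding imat_mult_defined_def using row_mult_upper_triangular(1) by blast

lemma imat_mult_upper_triangular:
  "upper_triangular Y \<Longrightarrow> n \<ge> 1 \<Longrightarrow> imat_mult X Y m n = (\<Sum>j = 1..n. X m j * Y j n)"
  by (simp add: imat_mult_def row_mult_upper_triangular(2))

lemma upper_triangular_imat_mult:
  assumes "upper_triangular X" "upper_triangular Y"
  shows "upper_triangular (imat_mult X Y)"
  unfolding upper_triangular_def
proof (intro allI impI)
  fix m n :: nat assume mn: "1 \<le> m" "1 \<le> n" "n < m"
  then have "\<And>j. j \<in> {1..n} \<Longrightarrow> X m j = 0" using assms(1) by (simp add: upper_triangular_def)
  then show "imat_mult X Y m n = 0"
    using imat_mult_upper_triangular[OF assms(2) mn(2)] by simp
qed

text \<open>All sums can be taken over \<open>1..n\<close>, so associativity is an interchange of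
  finite sums. In the role of \<open>X\<close> both \<open>B\<close> and the non-triangular
  \<open>E\<close> will occur.\<close>

lemma imat_mult_assoc:
  assumes Y: "upper_triangular Y" and Z: "upper_triangular Z" and n: "n \<ge> 1"
  shows "imat_mult (imat_mult X Y) Z m n = imat_mult X (imat_mult Y Z) m n"
proof -
  \<comment> \<open>Stretching the inner range from \<open>j\<close> to \<open>n\<close> adds only
    zeros and frees it from the outer index.\<close>
  have *: "imat_mult X Y m j = (\<Sum>i = 1..n. X m i * Y i j)" if "j \<in> {1..n}" for j
  proof -
    have "imat_mult X Y m j = (\<Sum>i = 1..j. X m i * Y i j)"
      using imat_mult_upper_triangular[OF Y] that by simp
    also have "\<dots> = (\<Sum>i = 1..n. X m i * Y i j)"
      using that Y by (intro sum.mono_neutral_left) (auto simp: upper_triangular_def)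
    finally show ?thesis .
  qed
  have "imat_mult (imat_mult X Y) Z m n = (\<Sum>j = 1..n. \<Sum>i = 1..n. X m i * Y i j * Z j n)"
    unfolding imat_mult_upper_triangular[OF Z n] using *
    by (intro sum.cong) (simp_all add: sum_distrib_right)
  also have "\<dots> = (\<Sum>i = 1..n. \<Sum>j = 1..n. X m i * Y i j * Z j n)" by (rule sum.swap)
  also have "\<dots> = imat_mult X (imat_mult Y Z) m n"
    unfolding imat_mult_upper_triangular[OF upper_triangular_imat_mult[OF Y Z] n]
      imat_mult_upper_triangular[OF Z n]
    by (simp add: sum_distrib_left mult.assoc)
  finally show ?thesis .
qed

section \<open>The identity matrix and cancellation on the left\<close>

lemma upper_triangular_imat_id: "upper_triangular imat_id"
  by (simp add: upper_triangular_def imat_id_def)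

lemma imat_mult_id_right: "n \<ge> 1 \<Longrightarrow> imat_mult X imat_id m n = X m n"
  by (simp add: imat_mult_upper_triangular[OF upper_triangular_imat_id] imat_id_def
      if_distrib[of "\<lambda>x. _ * x"] cong: if_cong)

lemma imat_mult_cong_right:
  assumes "upper_triangular Y" "upper_triangular Y'" "imat_eq Y Y'" "n \<ge> 1"
  shows "imat_mult X Y m n = imat_mult X Y' m n"
  using assms by (simp add: imat_mult_upper_triangular imat_eq_def)

lemma imat_mult_cong_left:
  assumes "upper_triangular Y" "imat_eq X X'" "m \<ge> 1" "n \<ge> 1"
  shows "imat_mult X Y m n = imat_mult X' Y m n"
  using assms by (simp add: imat_mult_upper_triangular imat_eq_def)

lemma imat_mult_id_left:
  assumes "upper_triangular X" "m \<ge> 1" "n \<ge> 1"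
  shows "imat_mult imat_id X m n = X m n"
proof -
  have "imat_mult imat_id X m n = (\<Sum>j = 1..n. if j = m then X j n else 0)"
    unfolding imat_mult_upper_triangular[OF assms(1,3)]
    by (intro sum.cong) (auto simp: imat_id_def)
  then show ?thesis using assms by (auto simp: upper_triangular_def)
qed

text \<open>Terms left of the diagonal of \<open>B\<close> vanish and the diagonal term is
  \<open>X m n\<close>. With \<open>C\<close> for \<open>X\<close>, this has the form of the
  recursion that defines \<open>C\<close>.\<close>

lemma imat_mult_unitriangular:
  assumes B: "upper_triangular B" "\<And>m. m \<ge> 1 \<Longrightarrow> B m m = 1"
    and X: "upper_triangular X" and mn: "1 \<le> m" "m \<le> n"
  shows "imat_mult B X m n = X m n + (\<Sum>j = m + 1..n. B m j * X j n)"
proof -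
  have "imat_mult B X m n = (\<Sum>j = 1..n. B m j * X j n)"
    using imat_mult_upper_triangular[OF X] mn by simp
  also have "\<dots> = (\<Sum>j = m..n. B m j * X j n)"
    using B(1) mn by (intro sum.mono_neutral_right) (auto simp: upper_triangular_def)
  also have "\<dots> = X m n + (\<Sum>j = m + 1..n. B m j * X j n)"
    using mn B(2) by (simp add: sum.atLeast_Suc_atMost)
  finally show ?thesis .
qed

text \<open>Back substitution: entry \<open>(m, n)\<close> of the product determines
  \<open>X m n\<close> once the entries further down in column \<open>n\<close> are known.\<close>

lemma imat_mult_unitriangular_cancel:
  assumes B: "upper_triangular B" "\<And>m. m \<ge> 1 \<Longrightarrow> B m m = 1"
    and XY: "upper_triangular X" "upper_triangular Y"
    and eq: "imat_eq (imat_mult B X) (imat_mult B Y)"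
  shows "imat_eq X Y"
  unfolding imat_eq_def
proof (intro allI impI)
  fix m n :: nat assume "1 \<le> m" and n: "1 \<le> n"
  then show "X m n = Y m n"
  \<comment> \<open>Induction on the distance up from row \<open>n + 1\<close>; from that row on,
    column \<open>n\<close> of both matrices is zero.\<close>
  proof (induction "Suc n - m" arbitrary: m rule: less_induct)
    case less
    show ?case
    proof (cases "m \<le> n")
      case True
      have "(\<Sum>j = m + 1..n. B m j * X j n) = (\<Sum>j = m + 1..n. B m j * Y j n)"
      proof (rule sum.cong[OF refl])
        fix j assume "j \<in> {m + 1..n}"
        then have "X j n = Y j n" using n by (intro less.hyps) auto
        then show "B m j * X j n = B m j * Y j n" by simp
      qed
      moreover have "imat_mult B X m n = imat_mult B Y m n"
        using eq less.prems by (simp add: imat_eq_def)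
      ultimately show ?thesis
        using imat_mult_unitriangular[OF B XY(1) less.prems(1) True]
          imat_mult_unitriangular[OF B XY(2) less.prems(1) True] by linarith
    next
      case False
      then show ?thesis using XY less.prems by (simp add: upper_triangular_def)
    qed
  qed
qed

section \<open>Enumerations of the finite posets\<close>

lemma poset_enumerationD:
  assumes "poset_enumeration P" "n \<ge> 1"
  shows "finite (P n)" "Partial_order (P n)"
proof -
  have "\<forall>n\<ge>1. finite (P n) \<and> Partial_order (P n)"
    using assms(1) unfolding poset_enumeration_def by (rule conjunct1)
  then show "finite (P n)" "Partial_order (P n)" using assms(2) by simp_all
qed

lemma poset_enumeration_iso_eq:
  assumes "poset_enumeration P" "m \<ge> 1" "n \<ge> 1" "P m \<simeq> P n"
  shows "m = n"
proof -
  have "\<forall>m\<ge>1. \<forall>n\<ge>1. P m \<simeq> P n \<longrightarrow> m = n"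
    using assms(1) unfolding poset_enumeration_def by (elim conjE)
  then show ?thesis using assms(2-4) by (elim allE impE)
qed

text \<open>An enumeration is only required to list the posets on natural numbers, so
  \<open>Q\<close> is first copied there.\<close>

lemma poset_enumeration_covers:
  assumes "poset_enumeration P" "finite Q" "Partial_order Q"
  obtains n where "n \<ge> 1" "Q \<simeq> P n"
proof -
  obtain Q' :: "nat rel" where Q': "finite Q'" "Partial_order Q'" "Q \<simeq> Q'"
    using assms(2,3) by (rule finite_poset_iso_nat)
  have "\<forall>Q :: nat rel. finite Q \<and> Partial_order Q \<longrightarrow> (\<exists>n\<ge>1. Q \<simeq> P n)"
    using assms(1) unfolding poset_enumeration_def by (elim conjE)
  then obtain n where "n \<ge> 1" "Q' \<simeq> P n" using Q'(1,2) by meson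
  then show ?thesis using poset_iso_trans[OF Q'(3)] by (intro that)
qed

text \<open>With only \<open>N\<close> points available, no \<open>P n\<close> could be an antichain
  of \<open>N + 1\<close> points. Infinitely many points are what allows new minimal elements to be
  placed outside a finite poset.\<close>

lemma poset_enumeration_infinite:
  fixes P :: "nat \<Rightarrow> 'a rel"
  assumes "poset_enumeration P"
  shows "infinite (UNIV :: 'a set)"
proof
  assume fin: "finite (UNIV :: 'a set)"
  define Q where "Q = Id_on {..card (UNIV :: 'a set)}"
  have F: "Field Q = {..card (UNIV :: 'a set)}" by (auto simp: Q_def Field_def)
  have "finite Q" unfolding Q_def
    by (rule finite_subset[of _ "{..card (UNIV :: 'a set)} \<times> {..card (UNIV :: 'a set)}"]) auto
  moreover have "Partial_order Q" unfolding F
    by (auto simp: Q_def partial_order_on_def preorder_on_def refl_on_def trans_def antisym_def)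
  ultimately obtain n where "Q \<simeq> P n" by (rule poset_enumeration_covers[OF assms])
  then have "card (Field (P n)) = Suc (card (UNIV :: 'a set))"
    using poset_iso_card_Field[of Q "P n"] F by simp
  moreover have "card (Field (P n)) \<le> card (UNIV :: 'a set)" by (rule card_mono[OF fin]) simp
  ultimately show False by simp
qed

text \<open>Compare numbers of points: if \<open>n \<le> m\<close>, then \<open>P n\<close> has at
  most as many points as \<open>P m\<close>, hence as \<open>U\<close>, so \<open>U\<close> is
  everything; in that case \<open>P m\<close> and \<open>P n\<close> are isomorphic and the indices
  agree. Triangularity and the unit diagonal of \<open>B\<close> both rest on this.\<close>

lemma upset_iso_index_le:
  assumes P: "poset_enumeration P" and mn: "m \<ge> 1" "n \<ge> 1"
    and U: "U \<in> upsets (P n)" "Restr (P n) U \<simeq> P m"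
  shows "m < n \<or> m = n \<and> U = Field (P n)"
proof -
  note Pn = poset_enumerationD[OF P mn(2)]
  have sub: "U \<subseteq> Field (P n)" using U(1) by (simp add: upsets_def)
  have cU: "card U = card (Field (P m))"
    using poset_iso_card_Field[OF U(2)] Partial_order_Field_Restr[OF Pn(2) sub] by simp
  have "U = Field (P n)" if "n \<le> m"
  proof (rule card_subset_eq[OF finite_Field[OF Pn(1)] sub])
    have "card (Field (P n)) \<le> card U"
      using P that mn unfolding cU poset_enumeration_def by blast
    then show "card U = card (Field (P n))"
      using card_mono[OF finite_Field[OF Pn(1)] sub] by simp
  qed
  moreover have "m = n" if "U = Field (P n)"
  proof -
    have "P m \<simeq> P n" using U(2) that by (simp add: Restr_Field_self poset_iso_sym)
    then show ?thesis by (rule poset_enumeration_iso_eq[OF P mn])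
  qed
  ultimately show ?thesis by force
qed

text \<open>\<open>A\<close> and \<open>B\<close> are instances with different weights, so that
  \<open>EA\<close> and \<open>EB\<close> can be computed together.\<close>

definition upset_mat :: "(nat \<Rightarrow> 'a rel) \<Rightarrow> ('a rel \<Rightarrow> 'a set \<Rightarrow> int) \<Rightarrow> imat"
  where "upset_mat P w m n = (\<Sum>U | U \<in> upsets (P n) \<and> Restr (P n) U \<simeq> P m. w (P n) U)"

lemma matA_eq_upset_mat: "matA P = upset_mat P (\<lambda>Q U. int (num_downsets (Restr Q (circ Q U))))"
  by (intro ext) (simp add: matA_def upset_mat_def)

lemma matB_eq_upset_mat: "matB P = upset_mat P (\<lambda>_ _. 1)"
  by (intro ext) (simp add: matB_def upset_mat_def)

lemma upper_triangular_upset_mat: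
  assumes P: "poset_enumeration P"
  shows "upper_triangular (upset_mat P w)"
  unfolding upper_triangular_def
proof (intro allI impI)
  fix m n :: nat assume "1 \<le> m" "1 \<le> n" "n < m"
  then have "{U. U \<in> upsets (P n) \<and> Restr (P n) U \<simeq> P m} = {}"
    using upset_iso_index_le[OF P] by fastforce
  then show "upset_mat P w m n = 0" unfolding upset_mat_def by (simp only: sum.empty)
qed

text \<open>Each upset induces a poset of exactly one listed type, of index at most
  \<open>n\<close>, so the double sum on the left meets each upset once. The assumption on
  \<open>g\<close> is invariance under the isomorphisms that occur.\<close>

lemma sum_upsets_group_by_iso_type:
  assumes P: "poset_enumeration P" and n: "n \<ge> 1"
    and g: "\<And>j U. j \<ge> 1 \<Longrightarrow> U \<in> upsets (P n) \<Longrightarrow> Restr (P n) U \<simeq> P j \<Longrightarrow> g (Restr (P n) U) = g (P j)"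
  shows "(\<Sum>j = 1..n. g (P j) * (\<Sum>U | U \<in> upsets (P n) \<and> Restr (P n) U \<simeq> P j. w U)) =
    (\<Sum>U\<in>upsets (P n). g (Restr (P n) U) * w U :: int)"
proof -
  note Pn = poset_enumerationD[OF P n]
  have "\<exists>j\<ge>1. Restr (P n) U \<simeq> P j" if "U \<in> upsets (P n)" for U
  proof -
    have "U \<subseteq> Field (P n)" using that by (simp add: upsets_def)
    then show ?thesis
      using poset_enumeration_covers[OF P finite_Restr[OF Pn(1)] Partial_order_Restr[OF Pn(2)]]
      by metis
  qed
  \<comment> \<open>\<open>t U\<close> is the index of the isomorphism type induced on
    \<open>U\<close>.\<close>
  then obtain t where t: "\<And>U. U \<in> upsets (P n) \<Longrightarrow> t U \<ge> 1 \<and> Restr (P n) U \<simeq> P (t U)" by metis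
  have t_iff: "Restr (P n) U \<simeq> P j \<longleftrightarrow> t U = j" if "U \<in> upsets (P n)" "j \<ge> 1" for U j
  proof
    assume "Restr (P n) U \<simeq> P j"
    then have "P (t U) \<simeq> P j" using t[OF that(1)] poset_iso_sym poset_iso_trans by metis
    then show "t U = j" using t[OF that(1)] that(2) by (intro poset_enumeration_iso_eq[OF P]) auto
  qed (use t[OF that(1)] in blast)
  have "t ` upsets (P n) \<subseteq> {1..n}" using t upset_iso_index_le[OF P _ n] by fastforce
  then have "(\<Sum>U\<in>upsets (P n). g (Restr (P n) U) * w U) =
      (\<Sum>j = 1..n. \<Sum>U | U \<in> upsets (P n) \<and> t U = j. g (Restr (P n) U) * w U)"
    by (intro sum.group[symmetric] finite_upsets Pn(1)) auto
  also have "\<dots> = (\<Sum>j = 1..n. g (P j) * (\<Sum>U | U \<in> upsets (P n) \<and> Restr (P n) U \<simeq> P j. w U))"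
    unfolding sum_distrib_left using t_iff g by (intro sum.cong) auto
  finally show ?thesis by simp
qed

section \<open>Products with the matrix \<open>E\<close>\<close>

lemma matE_eq_covers:
  assumes "poset_enumeration P" "n \<ge> 1"
  shows "matE P m n = int (card (upset_covers m (P n)))"
  unfolding matE_def
  using num_min_extensions_eq_covers[OF poset_enumeration_infinite[OF assms(1)]
      poset_enumerationD[OF assms]] by simp

text \<open>The number of covers is an isomorphism invariant, so \<open>matE P m j\<close> may be
  replaced by the number of covers of each upset of type \<open>P j\<close>; the sorting by type can
  then be undone.\<close>

lemma imat_mult_matE:
  assumes P: "poset_enumeration P" and n: "n \<ge> 1"
  shows "imat_mult (matE P) (upset_mat P w) m n =
    (\<Sum>U\<in>upsets (P n). int (card (upset_covers m (Restr (P n) U))) * w (P n) U)"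
proof -
  have "imat_mult (matE P) (upset_mat P w) m n =
      (\<Sum>j = 1..n. int (card (upset_covers m (P j))) * upset_mat P w j n)"
    unfolding imat_mult_upper_triangular[OF upper_triangular_upset_mat[OF P] n]
    using matE_eq_covers[OF P] by (intro sum.cong) auto
  also have "\<dots> = (\<Sum>U\<in>upsets (P n). int (card (upset_covers m (Restr (P n) U))) * w (P n) U)"
    unfolding upset_mat_def
  proof (rule sum_upsets_group_by_iso_type[OF P n, where g = "\<lambda>Q. int (card (upset_covers m Q))"])
    fix j U assume "j \<ge> 1" "Restr (P n) U \<simeq> P j"
    then show "int (card (upset_covers m (Restr (P n) U))) = int (card (upset_covers m (P j)))"
      using card_upset_covers_iso[OF finite_Restr] poset_enumerationD(1)[OF P] n by metis
  qed
  finally show ?thesis .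
qed

lemma matB_diag:
  assumes P: "poset_enumeration P" and n: "n \<ge> 1"
  shows "matB P n n = 1"
proof -
  have "{U \<in> upsets (P n). Restr (P n) U \<simeq> P n} = {Field (P n)}"
  proof (intro equalityI subsetI)
    fix U assume "U \<in> {U \<in> upsets (P n). Restr (P n) U \<simeq> P n}"
    then show "U \<in> {Field (P n)}" using upset_iso_index_le[OF P n n, of U] by simp
  next
    fix U assume "U \<in> {Field (P n)}"
    moreover have "Field (P n) \<in> upsets (P n)" by (auto simp: upsets_def FieldI2)
    ultimately show "U \<in> {U \<in> upsets (P n). Restr (P n) U \<simeq> P n}"
      by (simp add: Restr_Field_self poset_iso_refl)
  qed
  then show ?thesis by (simp add: matB_def)
qed

lemma upper_triangular_matC: "upper_triangular (matC P)"
  unfolding upper_triangular_def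
proof (intro allI impI)
  fix m n :: nat assume "n < m"
  then show "matC P m n = 0" using matC.simps[of P m n] by simp
qed

section \<open>The identities between the matrices\<close>

theorem theorem5p3:
  fixes P :: "nat \<Rightarrow> 'a rel"
  assumes "poset_enumeration P"
  shows "upper_triangular (matA P) \<and> upper_triangular (matB P) \<and> upper_triangular (matC P) \<and>
    (imat_mult_defined (matB P) (matC P) \<and> imat_eq (imat_mult (matB P) (matC P)) imat_id \<and>
      imat_inverse (matB P) (matC P)) \<and>
    (imat_mult_defined (matE P) (matB P) \<and> imat_eq (imat_mult (matE P) (matB P)) (matD P) \<and>
      imat_mult_defined (matD P) (matC P) \<and> imat_eq (imat_mult (matD P) (matC P)) (matE P)) \<and>
    (imat_mult_defined (matE P) (matA P) \<and> imat_mult_defined imat_shift (matE P) \<and>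
      imat_eq (imat_mult (matE P) (matA P)) (imat_mult imat_shift (matE P)) \<and>
      (\<forall>m\<ge>1. \<forall>n\<ge>1. row_mult (matE P m) (matA P) n = matE P (m + 1) n))"
proof -
  let ?A = "matA P" and ?B = "matB P" and ?C = "matC P" and ?D = "matD P" and ?E = "matE P"
  have A: "upper_triangular ?A" and B: "upper_triangular ?B"
    unfolding matA_eq_upset_mat matB_eq_upset_mat by (rule upper_triangular_upset_mat[OF assms])+
  note C = upper_triangular_matC[of P] and Id = upper_triangular_imat_id
  note B1 = matB_diag[OF assms]

  \<comment> \<open>On and above the diagonal this is the recursion for \<open>C\<close> with the
    unit diagonal term of \<open>B\<close> split off; below it both sides vanish.\<close>
  have BC: "imat_eq (imat_mult ?B ?C) imat_id"
    unfolding imat_eq_def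
  proof (intro allI impI)
    fix m n :: nat assume mn: "1 \<le> m" "1 \<le> n"
    show "imat_mult ?B ?C m n = imat_id m n"
    proof (cases "m \<le> n")
      case True
      then show ?thesis
        using imat_mult_unitriangular[OF B B1 C mn(1) True] matC.simps[of P m n]
        by (simp add: imat_id_def)
    next
      case False
      then show ?thesis
        using upper_triangular_imat_mult[OF B C] mn by (simp add: upper_triangular_def imat_id_def)
    qed
  qed
  \<comment> \<open>For infinite matrices a right inverse need not be a left one. Here
    \<open>B(CB) = (BC)B = B = BI\<close>, and \<open>B\<close> can be cancelled by back
    substitution.\<close>
  have "imat_eq (imat_mult ?B (imat_mult ?C ?B)) (imat_mult ?B imat_id)"
    unfolding imat_eq_def
  proof (intro allI impI)
    fix m n :: nat assume mn: "1 \<le> m" "1 \<le> n"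
    have "imat_mult ?B (imat_mult ?C ?B) m n = imat_mult (imat_mult ?B ?C) ?B m n"
      using imat_mult_assoc[OF C B mn(2)] by simp
    also have "\<dots> = imat_mult imat_id ?B m n" using imat_mult_cong_left[OF B BC] mn by simp
    finally show "imat_mult ?B (imat_mult ?C ?B) m n = imat_mult ?B imat_id m n"
      using imat_mult_id_left[OF B] imat_mult_id_right mn by simp
  qed
  then have CB: "imat_eq (imat_mult ?C ?B) imat_id"
    using imat_mult_unitriangular_cancel[OF B B1 upper_triangular_imat_mult[OF C B] Id] by simp

  have EB: "imat_eq (imat_mult ?E ?B) ?D"
    unfolding imat_eq_def
  proof (intro allI impI)
    fix m n :: nat assume n: "1 \<le> n"
    show "imat_mult ?E ?B m n = ?D m n"
      unfolding imat_mult_matE[OF assms n] matB_eq_upset_mat matD_def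
        sum_card_upset_covers_Restr[OF poset_enumerationD[OF assms n], symmetric]
      by simp
  qed
  have DC: "imat_eq (imat_mult ?D ?C) ?E"
    unfolding imat_eq_def
  proof (intro allI impI)
    fix m n :: nat assume mn: "1 \<le> m" "1 \<le> n"
    have "imat_mult ?D ?C m n = imat_mult (imat_mult ?E ?B) ?C m n"
      using imat_mult_cong_left[OF C EB mn] by simp
    also have "\<dots> = imat_mult ?E (imat_mult ?B ?C) m n" using imat_mult_assoc[OF B C mn(2)] .
    also have "\<dots> = imat_mult ?E imat_id m n"
      using imat_mult_cong_right[OF upper_triangular_imat_mult[OF B C] Id BC mn(2)] .
    finally show "imat_mult ?D ?C m n = ?E m n" using imat_mult_id_right[OF mn(2)] by simp
  qed

  \<comment> \<open>The weight that \<open>A\<close> gives to \<open>U\<close> is the number of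
    upsets that can be prepended to a cover of \<open>U\<close> so as to cover
    \<open>P n\<close>.\<close>
  have EA: "imat_mult ?E ?A m n = ?E (m + 1) n" if n: "n \<ge> 1" for m n
    unfolding matA_eq_upset_mat imat_mult_matE[OF assms n] matE_eq_covers[OF assms n]
    using card_upset_covers_Suc[OF poset_enumerationD[OF assms n]] by simp
  \<comment> \<open>\<open>E\<close> is not upper triangular, so finiteness comes instead from the
    shift matrix, whose row \<open>m\<close> has its only nonzero entry in column
    \<open>m + 1\<close>.\<close>
  have shift_support: "{j. 1 \<le> j \<and> imat_shift m j * ?E j n \<noteq> 0} \<subseteq> {m + 1}" for m n
    by (auto simp: imat_shift_def split: if_splits)
  have shift: "imat_mult imat_shift ?E m n = ?E (m + 1) n" for m n
  proof -
    have "imat_mult imat_shift ?E m n = (\<Sum>j\<in>{m + 1}. imat_shift m j * ?E j n)"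
      unfolding imat_mult_def row_mult_def
      by (rule sum.mono_neutral_left) (use shift_support[of m n] in auto)
    then show ?thesis by (simp add: imat_shift_def)
  qed
  have "imat_mult_defined imat_shift ?E"
    unfolding imat_mult_defined_def using finite_subset[OF shift_support] by blast
  moreover have "imat_eq (imat_mult ?E ?A) (imat_mult imat_shift ?E)"
    unfolding imat_eq_def using EA shift by simp
  moreover have "\<forall>m\<ge>1. \<forall>n\<ge>1. row_mult (?E m) ?A n = ?E (m + 1) n"
    using EA by (simp add: imat_mult_def)
  ultimately show ?thesis
    using A B C BC CB EB DC imat_mult_defined_upper_triangular unfolding imat_inverse_def by blast
qed

end
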